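(* Let $L^{(k)}(n)$ denote the number of $k$-MOLS of order $n$, and let $k=k(n)$. As $n\to\infty$ (i.e. for all sufficiently large $n$ in (i), and with $o(1)\to 0$ as $n\to\infty$ in (ii) and (iii)): (i) if $k=o(\log n)$, then $$\log L^{(k)}(n) \le \left(k\log n - \binom{k+2}{2} + 1 + k^2 n^{-1/(k+2)}\right) n^2;$$ (ii) if $k=\beta\log n$ for a fixed $\beta>0$, then $$\log L^{(k)}(n)\le (c(\beta)+o(1))\, k\, n^2\log n,$$ where $c(\beta) = 1-\beta^{-1}\int_0^\beta x\,(1-e^{-1/x})\,dx \in[0,1]$; (iii) if $k=\omega(\log n)$, then $$\log L^{(k)}(n)\le \left(\tfrac12+o(1)\right)(\log k-\log\log n)\, n^2\log^2 n.$$
   Context: Write $[n]=\{1,\dots,n\}$. A Latin square of order $n$ is an $n\times n$ matrix with entries in $[n]$ such that each $x\in[n]$ appears exactly once in every row and in every column. Two Latin squares $L,L'$ of order $n$ are orthogonal if for all $(x,y)\in[n]^2$ there exist unique $i,j\in[n]$ with $L(i,j)=x$ and $L'(i,j)=y$. A $k$-MOLS of order $n$ is an (ordered) $k$-tuple $(L_1,\dots,L_k)$ of Latin squares of order $n$ such that $L_i$ and $L_j$ are orthogonal for all $1\le i<j\le k$. All logarithms are natural, and $\log^2 n=(\log n)^2$; if $L^{(k)}(n)=0$ the bounds are vacuous ($\log 0=-\infty$). The notation $k=\omega(\log n)$ means $k/\log n\to\infty$. *)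

theory Defs
  imports "HOL-Analysis.Analysis" "HOL-Library.Landau_Symbols"
begin

text \<open>An order-\<open>n\<close> matrix is an extensional function on \<open>[n] \<times> [n]\<close>, so that distinct functions are
  distinct matrices and counting by \<open>card\<close> is meaningful.\<close>

definition latin_square :: "nat \<Rightarrow> (nat \<times> nat \<Rightarrow> nat) \<Rightarrow> bool" where
  "latin_square n L \<longleftrightarrow>
     L \<in> {1..n} \<times> {1..n} \<rightarrow>\<^sub>E {1..n} \<and>
     (\<forall>x\<in>{1..n}. (\<forall>i\<in>{1..n}. \<exists>!j\<in>{1..n}. L (i, j) = x) \<and>
                 (\<forall>j\<in>{1..n}. \<exists>!i\<in>{1..n}. L (i, j) = x))"

definition orthogonal_squares :: "nat \<Rightarrow> (nat \<times> nat \<Rightarrow> nat) \<Rightarrow> (nat \<times> nat \<Rightarrow> nat) \<Rightarrow> bool" where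
  "orthogonal_squares n L L' \<longleftrightarrow>
     (\<forall>x\<in>{1..n}. \<forall>y\<in>{1..n}. \<exists>!p\<in>{1..n} \<times> {1..n}. L p = x \<and> L' p = y)"

definition MOLS :: "nat \<Rightarrow> nat \<Rightarrow> (nat \<times> nat \<Rightarrow> nat) list set" where
  "MOLS k n = {Ls. length Ls = k \<and> (\<forall>L\<in>set Ls. latin_square n L) \<and>
     (\<forall>i j. i < j \<and> j < k \<longrightarrow> orthogonal_squares n (Ls ! i) (Ls ! j))}"

definition num_MOLS :: "nat \<Rightarrow> nat \<Rightarrow> nat" where
  "num_MOLS k n = card (MOLS k n)"

lemma finite_MOLS: "finite (MOLS k n)"
proof (rule finite_subset)
  show "MOLS k n \<subseteq> {Ls. set Ls \<subseteq> ({1..n} \<times> {1..n} \<rightarrow>\<^sub>E {1..n}) \<and> length Ls = k}"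
    unfolding MOLS_def latin_square_def by blast
  show "finite {Ls. set Ls \<subseteq> ({1..n} \<times> {1..n} \<rightarrow>\<^sub>E {1..n}) \<and> length Ls = k}"
    by (intro finite_lists_length_eq finite_PiE) auto
qed

text \<open>The integrand is continuous on \<open>[0, \<beta>]\<close>: its value at \<open>x = 0\<close> is \<open>0\<close>, which is also its limit
  from the right.\<close>

definition mols_const :: "real \<Rightarrow> real" where
  "mols_const \<beta> = 1 - inverse \<beta> * integral {0..\<beta>} (\<lambda>x. x * (1 - exp (- 1 / x)))"

end

theory Submission
  imports Defs "HOL-Real_Asymp.Real_Asymp"
begin

text \<open>
  Fix an \<open>m\<close>-MOLS and count the squares \<open>L\<close> extending it to an \<open>(m + 1)\<close>-MOLS by revealing the entries
  of \<open>L\<close> one cell at a time in a random order. A symbol other than the true one remains available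
  at a cell unless it occurs at one of the \<open>m + 2\<close> cells that carry it on a line (row, column or
  symbol class) through this cell and that have been revealed before. If the cell is revealed when
  a fraction \<open>t\<close> of the order is still to come, then on average about \<open>1 + (n - 1) t ^ (m + 2)\<close> symbols
  are available. A Kraft inequality for the revealing tree and two applications of Jensen's
  inequality bound the logarithm of the number of extensions by
  \<open>n\<^sup>2\<close> times the integral of \<open>ln (1 + (n - 1) t ^ d)\<close> over \<open>[0, 1]\<close>, where \<open>d = m + 2\<close>, and this integral
  is at most \<open>ln n - d (1 - n powr (- 1 / d)) + O(1 / d)\<close>. Summing over \<open>m < k\<close> gives the three regimes: with
  \<open>x = d / ln n\<close>, the terms \<open>d (1 - n powr (- 1 / d))\<close> form a Riemann sum of
  \<open>(ln n)\<^sup>2 * x (1 - exp (- 1 / x))\<close>.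
\<close>

section \<open>Entropy bound for a fixed revealing order\<close>

text \<open>If every vertex, in decreasing order of \<open>\<tau>\<close>, takes a uniform choice
  from its set \<open>A\<close>, the product is the probability of obtaining \<open>f\<close>. The
  vertex \<open>v\<close> of largest \<open>\<tau>\<close> is revealed first, so
  \<open>A f v\<close> is the same set for all \<open>f\<close>. Each fibre \<open>f v = x\<close>
  satisfies the hypotheses again on \<open>V - {v}\<close>, and at most \<open>card (A f v)\<close>
  fibres are nonempty.\<close>

lemma kraft_sum_le_1:
  fixes A :: "('a \<Rightarrow> 'b) \<Rightarrow> 'a \<Rightarrow> 'b set" and \<tau> :: "'a \<Rightarrow> nat"
  assumes "finite V" "finite F"
    and "\<And>f v. f \<in> F \<Longrightarrow> v \<in> V \<Longrightarrow> finite (A f v) \<and> f v \<in> A f v"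
    and "\<And>f g v. f \<in> F \<Longrightarrow> g \<in> F \<Longrightarrow> v \<in> V \<Longrightarrow>
           (\<And>u. u \<in> V \<Longrightarrow> \<tau> v < \<tau> u \<Longrightarrow> f u = g u) \<Longrightarrow> A f v = A g v"
    and "\<And>f g. f \<in> F \<Longrightarrow> g \<in> F \<Longrightarrow> (\<And>u. u \<in> V \<Longrightarrow> f u = g u) \<Longrightarrow> f = g"
  shows "(\<Sum>f\<in>F. \<Prod>v\<in>V. 1 / real (card (A f v))) \<le> 1"
  using assms
proof (induction "card V" arbitrary: V F)
  case 0
  have "V = {}" using 0(1,2) by simp
  have "f = g" if "f \<in> F" "g \<in> F" for f g
    by (rule 0(6)[OF that]) (simp add: \<open>V = {}\<close>)
  then have "F = {} \<or> (\<exists>f. F = {f})" by blast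
  then show ?case using \<open>V = {}\<close> by auto
next
  case (Suc m)
  have ne: "\<tau> ` V \<noteq> {}" using Suc(2) by auto
  have "Max (\<tau> ` V) \<in> \<tau> ` V" using \<open>finite V\<close> ne by (intro Max_in) auto
  then obtain v where v: "v \<in> V" "Max (\<tau> ` V) = \<tau> v" by blast
  then have vmax: "\<tau> u \<le> \<tau> v" if "u \<in> V" for u
    using \<open>finite V\<close> that by (metis Max_ge finite_imageI imageI)
  note v = v(1)
  show ?case
  proof (cases "F = {}")
    case False
    then obtain f0 where f0: "f0 \<in> F" by blast
    have Aeq: "A f v = A f0 v" if "f \<in> F" for f
    proof (rule Suc(6)[OF that f0 v])
      fix u assume "u \<in> V" "\<tau> v < \<tau> u"
      then show "f u = f0 u" using vmax[of u] by linarith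
    qed
    let ?B = "A f0 v" and ?P = "\<lambda>f. \<Prod>w\<in>V - {v}. 1 / real (card (A f w))"
    have finB: "finite ?B" and "f0 v \<in> ?B" using Suc(5)[OF f0 v] by auto
    then have cB: "card ?B > 0" by (auto simp: card_gt_0_iff)
    have fibre: "(\<Sum>f\<in>{f\<in>F. f v = x}. ?P f) \<le> 1" for x
    proof (rule Suc(1))
      show "m = card (V - {v})" using Suc(2) v by simp
    next
      fix f g w
      assume fg: "f \<in> {f \<in> F. f v = x}" "g \<in> {f \<in> F. f v = x}" "w \<in> V - {v}"
        and *: "\<And>u. u \<in> V - {v} \<Longrightarrow> \<tau> w < \<tau> u \<Longrightarrow> f u = g u"
      have "f \<in> F" "g \<in> F" "w \<in> V" using fg by auto
      then show "A f w = A g w"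
      proof (rule Suc(6))
        fix u assume "u \<in> V" "\<tau> w < \<tau> u"
        then show "f u = g u" using *[of u] fg by (cases "u = v") auto
      qed
    next
      fix f g
      assume fg: "f \<in> {f \<in> F. f v = x}" "g \<in> {f \<in> F. f v = x}"
        and *: "\<And>u. u \<in> V - {v} \<Longrightarrow> f u = g u"
      have "f \<in> F" "g \<in> F" using fg by auto
      then show "f = g"
      proof (rule Suc(7))
        fix u assume "u \<in> V"
        then show "f u = g u" using *[of u] fg by (cases "u = v") auto
      qed
    next
      fix f w assume "f \<in> {f \<in> F. f v = x}" "w \<in> V - {v}"
      then show "finite (A f w) \<and> f w \<in> A f w" using Suc(5)[of f w] by simp
    qed (use Suc(3,4) in simp_all)
    have "(\<Sum>f\<in>F. \<Prod>v\<in>V. 1 / real (card (A f v))) = (\<Sum>f\<in>F. 1 / card ?B * ?P f)"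
    proof (rule sum.cong[OF refl])
      fix f assume "f \<in> F"
      then show "(\<Prod>v\<in>V. 1 / real (card (A f v))) = 1 / card ?B * ?P f"
        using prod.remove[OF Suc(3) v, of "\<lambda>w. 1 / real (card (A f w))"] Aeq[of f] by simp
    qed
    also have "\<dots> = (\<Sum>x\<in>?B. \<Sum>f\<in>{f\<in>F. f v = x}. 1 / card ?B * ?P f)"
    proof (rule sum.group[symmetric])
      show "(\<lambda>f. f v) ` F \<subseteq> ?B" using Suc(5)[OF _ v] Aeq by blast
    qed (use finB Suc(4) in simp_all)
    also have "\<dots> \<le> (\<Sum>x\<in>?B. 1 / card ?B * 1)"
      unfolding sum_distrib_left[symmetric] by (intro sum_mono mult_left_mono fibre) auto
    also have "\<dots> \<le> 1" using cB by simp
    finally show ?thesis .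
  qed simp
qed

text \<open>The Kraft weights \<open>w f\<close> sum to at most 1, so the average of
  \<open>- ln (w f)\<close> over \<open>F\<close> is at least \<open>ln (card F)\<close>. This is
  the first use of Jensen, in the form \<open>ln z \<le> z - 1\<close> at
  \<open>z = w f * card F\<close>. Properness keeps the true value \<open>f v\<close> available, so
  no factor degenerates.\<close>

lemma ln_card_le_available:
  fixes X :: "'b set" and \<tau> :: "'a \<Rightarrow> nat"
  assumes V: "finite V" and X: "finite X" and F: "F \<subseteq> V \<rightarrow>\<^sub>E X"
    and adj: "\<And>f u v. f \<in> F \<Longrightarrow> u \<in> V \<Longrightarrow> v \<in> V \<Longrightarrow> adj u v \<Longrightarrow> f u \<noteq> f v"
  shows "real (card F) * ln (real (card F)) \<le>
    (\<Sum>f\<in>F. \<Sum>v\<in>V. ln (real (card {x\<in>X. \<forall>u\<in>V. adj u v \<and> \<tau> v < \<tau> u \<longrightarrow> f u \<noteq> x})))"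
proof (cases "F = {}")
  case False
  define A where "A f v = {x\<in>X. \<forall>u\<in>V. adj u v \<and> \<tau> v < \<tau> u \<longrightarrow> f u \<noteq> x}" for f v
  define w where "w f = (\<Prod>v\<in>V. 1 / real (card (A f v)))" for f
  have finF: "finite F" using F V X by (meson finite_PiE finite_subset)
  have mem: "finite (A f v) \<and> f v \<in> A f v" if "f \<in> F" "v \<in> V" for f v
    using that F X adj unfolding A_def by (auto dest: PiE_mem)
  have cA: "card (A f v) > 0" if "f \<in> F" "v \<in> V" for f v
    using mem[OF that] by (auto simp: card_gt_0_iff)
  have le1: "sum w F \<le> 1" unfolding w_def
  proof (rule kraft_sum_le_1[where \<tau> = \<tau>])
    show "finite V" "finite F" by (fact V finF)+
    show "finite (A f v) \<and> f v \<in> A f v" if "f \<in> F" "v \<in> V" for f :: "'a \<Rightarrow> 'b" and v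
      by (rule mem[OF that])
  next
    fix f g :: "'a \<Rightarrow> 'b" and v assume "\<And>u. u \<in> V \<Longrightarrow> \<tau> v < \<tau> u \<Longrightarrow> f u = g u"
    then show "A f v = A g v" unfolding A_def by auto
  next
    fix f g :: "'a \<Rightarrow> 'b" assume "f \<in> F" "g \<in> F" "\<And>u. u \<in> V \<Longrightarrow> f u = g u"
    then show "f = g" using F by (meson PiE_ext subsetD)
  qed
  let ?c = "real (card F)"
  have c: "?c > 0" using False finF by (simp add: card_gt_0_iff)
  have wpos: "w f > 0" if "f \<in> F" for f
    unfolding w_def using cA that by (intro prod_pos) simp
  have "(\<Sum>f\<in>F. ln (w f) + ln ?c) \<le> (\<Sum>f\<in>F. w f * ?c - 1)"
  proof (rule sum_mono)
    fix f assume "f \<in> F"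
    then show "ln (w f) + ln ?c \<le> w f * ?c - 1"
      using ln_le_minus_one[of "w f * ?c"] wpos c by (simp add: ln_mult_pos)
  qed
  also have "\<dots> = ?c * (sum w F - 1)"
    by (simp add: sum_subtractf sum_distrib_right[symmetric] algebra_simps)
  also have "\<dots> \<le> 0" using le1 c by (simp add: mult_le_0_iff)
  finally have "?c * ln ?c \<le> (\<Sum>f\<in>F. - ln (w f))"
    by (simp add: sum.distrib sum_negf)
  also have "\<dots> = (\<Sum>f\<in>F. \<Sum>v\<in>V. ln (real (card (A f v))))"
  proof (rule sum.cong[OF refl])
    fix f assume f: "f \<in> F"
    have "ln (w f) = (\<Sum>v\<in>V. ln (1 / real (card (A f v))))"
      unfolding w_def using cA[OF f] by (intro ln_prod[OF V]) simp
    also have "\<dots> = (\<Sum>v\<in>V. - ln (real (card (A f v))))"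
      using cA[OF f] by (intro sum.cong refl) (simp add: ln_div)
    finally show "- ln (w f) = (\<Sum>v\<in>V. ln (real (card (A f v))))" by (simp add: sum_negf)
  qed
  finally show ?thesis unfolding A_def .
qed simp

section \<open>Averaging over random labellings\<close>

text \<open>Labels are independent and uniform: once \<open>v\<close> has label \<open>s\<close>,
  each cell of \<open>D\<close> has label at most \<open>s\<close> with probability
  \<open>s / M\<close>. Cells of \<open>D\<close> beyond the first \<open>d\<close> only lower the
  count, as \<open>s / M \<le> 1\<close>.\<close>

lemma card_labellings_le:
  fixes s M :: nat
  assumes V: "finite V" "v \<in> V" and D: "D \<subseteq> V - {v}" "d \<le> card D" and s: "s \<in> {1..M}"
  shows "real (card {\<tau> \<in> V \<rightarrow>\<^sub>E {1..M}. \<tau> v = s \<and> (\<forall>u\<in>D. \<tau> u \<le> s)})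
      \<le> real M ^ (card V - 1) * (real s / real M) ^ d"
proof -
  have "{\<tau> \<in> V \<rightarrow>\<^sub>E {1..M}. \<tau> v = s \<and> (\<forall>u\<in>D. \<tau> u \<le> s)}
      = PiE V (\<lambda>w. if w = v then {s} else if w \<in> D then {1..s} else {1..M})" (is "_ = PiE V ?S")
  proof (intro set_eqI iffI)
    fix \<tau> assume "\<tau> \<in> {\<tau> \<in> V \<rightarrow>\<^sub>E {1..M}. \<tau> v = s \<and> (\<forall>u\<in>D. \<tau> u \<le> s)}"
    then show "\<tau> \<in> PiE V ?S" by (auto simp: PiE_iff)
  next
    fix \<tau> assume t: "\<tau> \<in> PiE V ?S"
    have "\<tau> v = s" using PiE_mem[OF t V(2)] by simp
    moreover have "\<tau> u \<le> s" if "u \<in> D" for u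
      using PiE_mem[OF t, of u] D that by (auto split: if_splits)
    moreover have "?S w \<subseteq> {1..M}" for w using s by auto
    then have "\<tau> \<in> V \<rightarrow>\<^sub>E {1..M}" using t PiE_mono by blast
    ultimately show "\<tau> \<in> {\<tau> \<in> V \<rightarrow>\<^sub>E {1..M}. \<tau> v = s \<and> (\<forall>u\<in>D. \<tau> u \<le> s)}" by blast
  qed
  then have "real (card {\<tau> \<in> V \<rightarrow>\<^sub>E {1..M}. \<tau> v = s \<and> (\<forall>u\<in>D. \<tau> u \<le> s)})
      = (\<Prod>w\<in>V. real (card (?S w)))"
    using V by (simp add: card_PiE)
  also have "\<dots> = (\<Prod>w\<in>V - {v}. real M * (if w \<in> D then real s / real M else 1))"
    using V s by (simp add: prod.remove[of V v]) (intro prod.cong, auto)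
  also have "\<dots> = real M ^ (card V - 1) * (\<Prod>w\<in>V - {v}. if w \<in> D then real s / real M else 1)"
    using V by (simp add: prod.distrib)
  also have "(\<Prod>w\<in>V - {v}. if w \<in> D then real s / real M else 1) = (real s / real M) ^ card D"
  proof -
    have "(V - {v}) \<inter> {w. w \<in> D} = D" using D by blast
    then show ?thesis using V by (simp add: prod.If_cases)
  qed
  also have "real M ^ (card V - 1) * \<dots> \<le> real M ^ (card V - 1) * (real s / real M) ^ d"
    using s D by (intro mult_left_mono power_decreasing) auto
  finally show ?thesis .
qed

text \<open>Jensen for the logarithm through its tangent at \<open>a\<close>, where \<open>a\<close>
  need only bound the average from above.\<close>

lemma sum_ln_le_card_ln_average:
  fixes f :: "'a \<Rightarrow> real"
  assumes "finite T" "T \<noteq> {}" "\<And>t. t \<in> T \<Longrightarrow> f t > 0" "sum f T \<le> real (card T) * a"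
  shows "(\<Sum>t\<in>T. ln (f t)) \<le> real (card T) * ln a"
proof -
  have cT: "real (card T) > 0" using assms by (simp add: card_gt_0_iff)
  have "sum f T > 0" using assms by (intro sum_pos) auto
  then have "real (card T) * a > 0" using assms(4) by linarith
  then have a: "a > 0" using cT by (simp add: zero_less_mult_iff)
  have "(\<Sum>t\<in>T. ln (f t)) \<le> (\<Sum>t\<in>T. ln a + (f t / a - 1))"
  proof (rule sum_mono)
    fix t assume t: "t \<in> T"
    then have "ln (f t / a) \<le> f t / a - 1" using assms(3) a by (intro ln_le_minus_one) simp
    then show "ln (f t) \<le> ln a + (f t / a - 1)" using assms(3)[OF t] a by (simp add: ln_div)
  qed
  also have "\<dots> = real (card T) * ln a + (sum f T / a - card T)"
    by (simp add: sum.distrib sum_subtractf sum_divide_distrib)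
  also have "\<dots> \<le> real (card T) * ln a" using assms(4) a by (simp add: field_simps)
  finally show ?thesis .
qed

text \<open>The random order is discretised: cells carry labels in \<open>{1..M}\<close>, higher labels are revealed
  first, and a cell with the same label counts as not yet revealed, which only enlarges the set of
  available symbols.\<close>

lemma ln_card_proper_colourings_le:
  fixes X :: "'b set" and M :: nat
  assumes V: "finite V" and X: "finite X" and F: "F \<subseteq> V \<rightarrow>\<^sub>E X" "F \<noteq> {}" and M: "M > 0"
    and adj: "\<And>f u v. f \<in> F \<Longrightarrow> u \<in> V \<Longrightarrow> v \<in> V \<Longrightarrow> adj u v \<Longrightarrow> f u \<noteq> f v"
    and deg: "\<And>f v x. f \<in> F \<Longrightarrow> v \<in> V \<Longrightarrow> x \<in> X \<Longrightarrow> x \<noteq> f v \<Longrightarrow>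
               d \<le> card {u\<in>V. adj u v \<and> f u = x}"
  shows "ln (real (card F)) \<le>
    real (card V) * ((\<Sum>s=1..M. ln (1 + (real (card X) - 1) * (real s / real M) ^ d)) / real M)"
proof -
  define T where "T = V \<rightarrow>\<^sub>E {1..M}"
  define q where "q = card V"
  let ?A = "\<lambda>f v \<tau>. {x\<in>X. \<forall>u\<in>V. adj u v \<and> \<tau> v < \<tau> u \<longrightarrow> f u \<noteq> x}"
  let ?h = "\<lambda>s. ln (1 + (real (card X) - 1) * (real s / real M) ^ d)"
  have finF: "finite F" using F V X by (meson finite_PiE finite_subset)
  have finT: "finite T" unfolding T_def using V by (simp add: finite_PiE)
  have cT: "card T = M ^ q" unfolding T_def q_def using V by (simp add: card_PiE)
  \<comment> \<open>Given label \<open>s\<close> at \<open>v\<close>, the mean number of available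
    symbols is at most the argument of the logarithm in \<open>?h s\<close>; the second use of
    Jensen moves the mean inside the logarithm.\<close>
  have slice: "(\<Sum>\<tau>\<in>{\<tau>\<in>T. \<tau> v = s}. ln (real (card (?A f v \<tau>)))) \<le> real M ^ (q - 1) * ?h s"
    if f: "f \<in> F" and v: "v \<in> V" and s: "s \<in> {1..M}" for f v s
  proof -
    let ?Ts = "{\<tau>\<in>T. \<tau> v = s}"
    have Ts: "?Ts = PiE V (\<lambda>w. if w = v then {s} else {1..M})"
    proof (intro set_eqI iffI)
      fix \<tau> assume "\<tau> \<in> ?Ts"
      then show "\<tau> \<in> PiE V (\<lambda>w. if w = v then {s} else {1..M})" by (auto simp: PiE_iff T_def)
    next
      fix \<tau> assume t: "\<tau> \<in> PiE V (\<lambda>w. if w = v then {s} else {1..M})"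
      have "\<tau> v = s" using PiE_mem[OF t v] by simp
      moreover have "(if w = v then {s} else {1..M}) \<subseteq> {1..M}" for w using s by auto
      then have "\<tau> \<in> T" using t PiE_mono unfolding T_def by blast
      ultimately show "\<tau> \<in> ?Ts" by blast
    qed
    have cTs: "card ?Ts = M ^ (q - 1)"
      unfolding Ts q_def using V v by (simp add: card_PiE prod.remove[of V v])
    have Xfv: "f v \<in> X" using f v F by (auto dest: PiE_mem)
    have fv: "\<And>\<tau>. f v \<in> ?A f v \<tau>" using f v adj Xfv by auto
    have "(\<Sum>\<tau>\<in>?Ts. real (card (?A f v \<tau>))) = (\<Sum>\<tau>\<in>?Ts. \<Sum>x\<in>X. of_bool (x \<in> ?A f v \<tau>))"
      using X by (intro sum.cong refl) (simp add: Int_def)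
    also have "\<dots> = (\<Sum>x\<in>X. \<Sum>\<tau>\<in>?Ts. of_bool (x \<in> ?A f v \<tau>))" by (rule sum.swap)
    \<comment> \<open>The true symbol is available for every labelling. Any other symbol survives
      only if all of its witnesses, at least \<open>d\<close> in number, have labels at most
      \<open>s\<close>.\<close>
    also have "\<dots> \<le> (\<Sum>x\<in>X. real M ^ (q - 1) * (if x = f v then 1 else (real s / real M) ^ d))"
    proof (rule sum_mono)
      fix x assume x: "x \<in> X"
      let ?D = "{u\<in>V. adj u v \<and> f u = x}"
      have eq: "(\<Sum>\<tau>\<in>?Ts. of_bool (x \<in> ?A f v \<tau>)) = real (card {\<tau> \<in> ?Ts. x \<in> ?A f v \<tau>})"
        using finT by (simp add: Int_def cong: conj_cong)
      show "(\<Sum>\<tau>\<in>?Ts. of_bool (x \<in> ?A f v \<tau>))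
          \<le> real M ^ (q - 1) * (if x = f v then 1 else (real s / real M) ^ d)"
      proof (cases "x = f v")
        case True
        have "real (card {\<tau> \<in> ?Ts. x \<in> ?A f v \<tau>}) \<le> real (card ?Ts)"
          using finT by (intro of_nat_mono card_mono) auto
        then have "(\<Sum>\<tau>\<in>?Ts. of_bool (x \<in> ?A f v \<tau>)) \<le> real M ^ (q - 1)"
          unfolding eq cTs by (simp only: of_nat_power)
        then show ?thesis unfolding if_P[OF True] mult_1_right .
      next
        case False
        have "{\<tau> \<in> ?Ts. x \<in> ?A f v \<tau>} = {\<tau> \<in> V \<rightarrow>\<^sub>E {1..M}. \<tau> v = s \<and> (\<forall>u\<in>?D. \<tau> u \<le> s)}"
          using x unfolding T_def by (auto simp: not_less)
        moreover have "?D \<subseteq> V - {v}" using adj f v by blast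
        ultimately show ?thesis
          unfolding eq using False card_labellings_le[OF V v, of ?D d s M] deg[OF f v x] s
          by (simp add: q_def)
      qed
    qed
    also have "\<dots> = real M ^ (q - 1) * (1 + (real (card X) - 1) * (real s / real M) ^ d)"
    proof -
      have "card X > 0" using Xfv X by (auto simp: card_gt_0_iff)
      then show ?thesis using X Xfv
        by (simp add: sum_distrib_left[symmetric] sum.remove[of X "f v"] of_nat_diff
            algebra_simps)
    qed
    finally have "(\<Sum>\<tau>\<in>?Ts. real (card (?A f v \<tau>)))
        \<le> card ?Ts * (1 + (real (card X) - 1) * (real s / real M) ^ d)" by (simp add: cTs)
    moreover have "?Ts \<noteq> {}" 
    proof
      assume "?Ts = {}"
      then have "M ^ (q - 1) = 0" using cTs by (simp only: card.empty)
      then show False using M by simp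
    qed
    moreover have "real (card (?A f v \<tau>)) > 0" for \<tau> using fv[of \<tau>] X by (auto simp: card_gt_0_iff)
    moreover have "finite ?Ts" using finT by simp
    ultimately have "(\<Sum>\<tau>\<in>?Ts. ln (real (card (?A f v \<tau>)))) \<le> real (card ?Ts) * ?h s"
      by (intro sum_ln_le_card_ln_average)
    then show ?thesis by (simp add: cTs)
  qed
  let ?c = "real (card F)"
  have c: "?c > 0" using F finF by (simp add: card_gt_0_iff)
  \<comment> \<open>The bound for a fixed order is summed over all \<open>M ^ q\<close> labellings;
    for each cell they are then grouped by the label of that cell.\<close>
  have "real M ^ q * (?c * ln ?c) = (\<Sum>\<tau>\<in>T. ?c * ln ?c)" by (simp add: cT)
  also have "\<dots> \<le> (\<Sum>\<tau>\<in>T. \<Sum>f\<in>F. \<Sum>v\<in>V. ln (real (card (?A f v \<tau>))))"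
    by (intro sum_mono ln_card_le_available V X F adj)
  also have "\<dots> = (\<Sum>f\<in>F. \<Sum>v\<in>V. \<Sum>\<tau>\<in>T. ln (real (card (?A f v \<tau>))))"
    by (subst sum.swap, intro sum.cong refl, rule sum.swap)
  also have "\<dots> = (\<Sum>f\<in>F. \<Sum>v\<in>V. \<Sum>s=1..M. \<Sum>\<tau>\<in>{\<tau>\<in>T. \<tau> v = s}. ln (real (card (?A f v \<tau>))))"
    using finT by (intro sum.cong refl sum.group[symmetric]) (auto simp: T_def dest: PiE_mem)
  also have "\<dots> \<le> (\<Sum>f\<in>F. \<Sum>v\<in>V. \<Sum>s=1..M. real M ^ (q - 1) * ?h s)"
    by (intro sum_mono slice)
  also have "\<dots> = ?c * (real q * real M ^ (q - 1)) * (\<Sum>s=1..M. ?h s)"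
    by (simp add: sum_distrib_left[symmetric] q_def)
  \<comment> \<open>For \<open>q = 0\<close> the truncated \<open>q - 1\<close> is harmless, since
    both sides vanish.\<close>
  also have "real q * real M ^ (q - 1) = real q * real M ^ q / real M"
    using M by (cases q) auto
  finally have "(real M ^ q * ?c) * ln ?c
      \<le> (real M ^ q * ?c) * (real q * ((\<Sum>s=1..M. ?h s) / real M))"
    by (simp add: mult_ac)
  moreover have "real M ^ q * ?c > 0" using M c by simp
  ultimately show ?thesis unfolding q_def by (rule mult_left_le_imp_le)
qed

section \<open>Nets and extensions of MOLS\<close>

text \<open>Brings the Latin condition into the shape of orthogonality, with the row index
  \<open>fst\<close> in place of a second square; \<open>snd\<close> is treated likewise below.
  Rows, columns and squares then become interchangeable coordinates of a net.\<close>

lemma latin_square_row: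
  assumes "latin_square n L" "x \<in> {1..n}" "y \<in> {1..n}"
  shows "\<exists>!p\<in>{1..n} \<times> {1..n}. fst p = x \<and> L p = y"
proof -
  have "\<exists>!j\<in>{1..n}. L (x, j) = y"
    using bspec[OF conjunct1[OF bspec[OF conjunct2[OF assms(1)[unfolded latin_square_def]] assms(3)]] assms(2)] .
  then obtain j where j: "j \<in> {1..n}" "L (x, j) = y"
    and uniq: "\<And>j'. j' \<in> {1..n} \<Longrightarrow> L (x, j') = y \<Longrightarrow> j' = j"
    by blast
  show ?thesis
  proof (rule ex1I[of _ "(x, j)"])
    fix p assume "p \<in> {1..n} \<times> {1..n} \<and> fst p = x \<and> L p = y"
    then show "p = (x, j)" using uniq[of "snd p"] by (cases p) auto
  qed (use j assms in auto)
qed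

lemma latin_square_column:
  assumes "latin_square n L" "x \<in> {1..n}" "y \<in> {1..n}"
  shows "\<exists>!p\<in>{1..n} \<times> {1..n}. snd p = x \<and> L p = y"
proof -
  have "\<exists>!i\<in>{1..n}. L (i, x) = y"
    using bspec[OF conjunct2[OF bspec[OF conjunct2[OF assms(1)[unfolded latin_square_def]] assms(3)]] assms(2)] .
  then obtain i where i: "i \<in> {1..n}" "L (i, x) = y"
    and uniq: "\<And>i'. i' \<in> {1..n} \<Longrightarrow> L (i', x) = y \<Longrightarrow> i' = i"
    by blast
  show ?thesis
  proof (rule ex1I[of _ "(i, x)"])
    fix p assume "p \<in> {1..n} \<times> {1..n} \<and> snd p = x \<and> L p = y"
    then show "p = (i, x)" using uniq[of "fst p"] by (cases p) auto
  qed (use i assms in auto)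
qed

lemma MOLS_append:
  assumes "Ls @ [L] \<in> MOLS (Suc m) n"
  shows "Ls \<in> MOLS m n" "latin_square n L" "\<And>i. i < m \<Longrightarrow> orthogonal_squares n (Ls ! i) L"
proof -
  have len: "length Ls = m" and lat: "\<forall>K\<in>set (Ls @ [L]). latin_square n K"
    and orth: "\<And>i j. i < j \<Longrightarrow> j < Suc m \<Longrightarrow> orthogonal_squares n ((Ls @ [L]) ! i) ((Ls @ [L]) ! j)"
    using assms unfolding MOLS_def by auto
  show "Ls \<in> MOLS m n" unfolding MOLS_def
  proof (intro CollectI conjI allI impI)
    fix i j assume "i < j \<and> j < m"
    then show "orthogonal_squares n (Ls ! i) (Ls ! j)"
      using orth[of i j] len by (simp add: nth_append)
  qed (use len lat in auto)
  show "latin_square n L" using lat by auto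
  show "orthogonal_squares n (Ls ! i) L" if "i < m" for i
    using orth[of i m] len that by (simp add: nth_append)
qed

text \<open>The rows, the columns and the symbol classes of the given squares form \<open>m + 2\<close> parallel classes
  of a net on the cells; a further orthogonal square colours the cells so that every line is
  rainbow, and a symbol occurring off a cell is seen from that cell along \<open>m + 2\<close> different lines.\<close>

lemma ln_card_extensions_le:
  fixes M :: nat
  assumes Ls: "Ls \<in> MOLS m n" and M: "M > 0"
    and F_def: "F = {L. Ls @ [L] \<in> MOLS (Suc m) n}" and ne: "F \<noteq> {}"
  shows "ln (real (card F)) \<le> (real n)\<^sup>2 *
    ((\<Sum>s=1..M. ln (1 + (real n - 1) * (real s / real M) ^ (m + 2))) / real M)"
proof -
  define V where "V = {1..n} \<times> {1..n}"
  \<comment> \<open>Classes 0 and 1 are rows and columns and the given squares follow, hence the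
    shift by 2 and the total of \<open>m + 2\<close> classes.\<close>
  define c :: "nat \<Rightarrow> nat \<times> nat \<Rightarrow> nat"
    where "c i = (if i = 0 then fst else if i = 1 then snd else Ls ! (i - 2))" for i
  define adj where "adj p q \<longleftrightarrow> p \<noteq> q \<and> (\<exists>i<m + 2. c i p = c i q)" for p q
  have len: "length Ls = m" and lat: "\<And>i. i < m \<Longrightarrow> latin_square n (Ls ! i)"
    and orth: "\<And>i j. i < j \<Longrightarrow> j < m \<Longrightarrow> orthogonal_squares n (Ls ! i) (Ls ! j)"
    using Ls unfolding MOLS_def by auto
  have c_in: "c i p \<in> {1..n}" if p: "p \<in> V" and i: "i < m + 2" for i p
  proof (cases "i < 2")
    case True
    then show ?thesis using p unfolding c_def V_def by auto
  next
    case False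
    then have "latin_square n (Ls ! (i - 2))" using i by (intro lat) simp
    then have "Ls ! (i - 2) \<in> V \<rightarrow>\<^sub>E {1..n}" unfolding latin_square_def V_def by blast
    then show ?thesis using False p unfolding c_def by (auto dest!: PiE_mem)
  qed
  have lat_net: "\<exists>!p\<in>V. c i p = x \<and> K p = y"
    if "latin_square n K" "i < 2" "x \<in> {1..n}" "y \<in> {1..n}" for K i x y
    using latin_square_row[OF that(1,3,4)] latin_square_column[OF that(1,3,4)] that(2)
    unfolding c_def V_def by (cases "i = 0") auto
  have net_L: "\<exists>!p\<in>V. c i p = x \<and> L p = y"
    if L: "L \<in> F" and i: "i < m + 2" and xy: "x \<in> {1..n}" "y \<in> {1..n}" for L i x y
  proof (cases "i < 2")
    case True
    then show ?thesis using lat_net MOLS_append(2) L xy unfolding F_def by blast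
  next
    case False
    then have "orthogonal_squares n (Ls ! (i - 2)) L"
      using MOLS_append(3)[of Ls L m n "i - 2"] L i unfolding F_def by simp
    then have "\<exists>!p\<in>V. (Ls ! (i - 2)) p = x \<and> L p = y"
      using xy unfolding orthogonal_squares_def V_def by blast
    then show ?thesis using False unfolding c_def by simp
  qed
  have net_c: "\<exists>!p\<in>V. c i p = x \<and> c j p = y"
    if ij: "i < j" "j < m + 2" and xy: "x \<in> {1..n}" "y \<in> {1..n}" for i j x y
  proof (cases "j < 2")
    case True
    then have "i = 0" "j = 1" using ij by auto
    then show ?thesis using xy unfolding c_def V_def by (intro ex1I[of _ "(x, y)"]) auto
  next
    case False
    then have cj: "c j = Ls ! (j - 2)" by (auto simp: c_def)
    show ?thesis
    proof (cases "i < 2")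
      case True
      moreover have "latin_square n (c j)" using cj lat[of "j - 2"] ij False by simp
      ultimately show ?thesis using lat_net xy by blast
    next
      case i: False
      then have "orthogonal_squares n (c i) (c j)"
        using cj orth[of "i - 2" "j - 2"] ij False by (simp add: c_def)
      then show ?thesis using xy unfolding orthogonal_squares_def V_def by blast
    qed
  qed
  have FE: "F \<subseteq> V \<rightarrow>\<^sub>E {1..n}"
    using MOLS_append(2) unfolding F_def latin_square_def V_def by blast
  have rainbow: "L p \<noteq> L q" if L: "L \<in> F" and p: "p \<in> V" and q: "q \<in> V" and pq: "adj p q" for L p q
  proof
    assume eq: "L p = L q"
    obtain i where i: "i < m + 2" "c i p = c i q" and "p \<noteq> q" using pq unfolding adj_def by blast
    have "L p \<in> {1..n}" by (rule PiE_mem[OF subsetD[OF FE L] p])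
    then have "\<exists>!r\<in>V. c i r = c i p \<and> L r = L p"
      using net_L[OF L i(1)] c_in[OF p i(1)] by blast
    then show False using p q eq i(2) \<open>p \<noteq> q\<close> by (metis (no_types, lifting))
  qed
  have deg: "m + 2 \<le> card {q\<in>V. adj q p \<and> L q = x}"
    if L: "L \<in> F" and p: "p \<in> V" and x: "x \<in> {1..n}" "x \<noteq> L p" for L p x
  proof -
    have "\<forall>i\<in>{..<m + 2}. \<exists>q. q \<in> V \<and> c i q = c i p \<and> L q = x"
    proof
      fix i assume "i \<in> {..<m + 2}"
      then have i: "i < m + 2" by simp
      show "\<exists>q. q \<in> V \<and> c i q = c i p \<and> L q = x"
        using net_L[OF L i c_in[OF p i] x(1)] by blast
    qed
    then obtain g where g: "\<And>i. i < m + 2 \<Longrightarrow> g i \<in> V \<and> c i (g i) = c i p \<and> L (g i) = x"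
      by (metis lessThan_iff)
    \<comment> \<open>If two witnesses coincided, their cell would share with \<open>p\<close> its
      lines in two classes and so be \<open>p\<close> itself, which carries
      \<open>L p \<noteq> x\<close>.\<close>
    have gneq: "g i \<noteq> g j" if "i < j" "j < m + 2" for i j
    proof
      assume eq: "g i = g j"
      have "i < m + 2" using that by simp
      note gi = g[OF this] and gj = g[OF that(2)]
      have "\<exists>!r\<in>V. c i r = c i p \<and> c j r = c j p"
        using net_c[OF that c_in[OF p] c_in[OF p]] that by simp
      then have "g i = p" using gi gj eq p by metis
      then show False using gi x by simp
    qed
    have "inj_on g {..<m + 2}"
    proof (rule inj_onI)
      fix i j assume "i \<in> {..<m + 2}" "j \<in> {..<m + 2}" "g i = g j"
      then show "i = j" using gneq[of i j] gneq[of j i] by (cases i j rule: linorder_cases) auto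
    qed
    moreover have "g ` {..<m + 2} \<subseteq> {q\<in>V. adj q p \<and> L q = x}"
    proof
      fix q assume "q \<in> g ` {..<m + 2}"
      then obtain i where i: "i < m + 2" "q = g i" by auto
      then show "q \<in> {q\<in>V. adj q p \<and> L q = x}"
        using g[OF i(1)] x(2) unfolding adj_def by auto
    qed
    ultimately have "card {..<m + 2} \<le> card {q\<in>V. adj q p \<and> L q = x}"
      by (intro card_inj_on_le[of g]) (auto simp: V_def)
    then show ?thesis by simp
  qed
  have "ln (real (card F)) \<le> real (card V) *
      ((\<Sum>s=1..M. ln (1 + (real (card {1..n}) - 1) * (real s / real M) ^ (m + 2))) / real M)"
  proof (rule ln_card_proper_colourings_le[where adj = adj])
    show "finite V" by (simp add: V_def)
    show "L p \<noteq> L q" if "L \<in> F" "p \<in> V" "q \<in> V" "adj p q" for L p q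
      by (rule rainbow[OF that])
    show "m + 2 \<le> card {q\<in>V. adj q p \<and> L q = x}"
      if "L \<in> F" "p \<in> V" "x \<in> {1..n}" "x \<noteq> L p" for L p x
      by (rule deg[OF that])
  qed (fact finite_atLeastAtMost FE ne M)+
  then show ?thesis by (simp add: V_def power2_eq_square)
qed

text \<open>Deleting the last square maps \<open>MOLS (Suc m) n\<close> into
  \<open>MOLS m n\<close>, and the fibre over \<open>Ls\<close> is its set of extensions.\<close>

lemma num_MOLS_Suc_le:
  assumes B: "B \<ge> 0" and ext: "\<And>Ls. Ls \<in> MOLS m n \<Longrightarrow> real (card {L. Ls @ [L] \<in> MOLS (Suc m) n}) \<le> B"
  shows "real (num_MOLS (Suc m) n) \<le> real (num_MOLS m n) * B"
proof -
  have inj: "inj_on (\<lambda>L. Ls @ [L]) A" for Ls and A :: "(nat \<times> nat \<Rightarrow> nat) set"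
    by (auto intro: inj_onI)
  have "MOLS (Suc m) n \<subseteq> (\<Union>Ls\<in>MOLS m n. (\<lambda>L. Ls @ [L]) ` {L. Ls @ [L] \<in> MOLS (Suc m) n})"
  proof
    fix Ks assume Ks: "Ks \<in> MOLS (Suc m) n"
    then have "length Ks = Suc m" by (simp add: MOLS_def)
    then obtain Ls L where "Ks = Ls @ [L]" by (metis length_Suc_conv_rev)
    then show "Ks \<in> (\<Union>Ls\<in>MOLS m n. (\<lambda>L. Ls @ [L]) ` {L. Ls @ [L] \<in> MOLS (Suc m) n})"
      using Ks MOLS_append(1) by blast
  qed
  moreover have fin: "finite ((\<lambda>L. Ls @ [L]) ` {L. Ls @ [L] \<in> MOLS (Suc m) n})" for Ls
    by (rule finite_subset[OF _ finite_MOLS[of "Suc m" n]]) auto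
  ultimately have "card (MOLS (Suc m) n)
      \<le> card (\<Union>Ls\<in>MOLS m n. (\<lambda>L. Ls @ [L]) ` {L. Ls @ [L] \<in> MOLS (Suc m) n})"
    using finite_MOLS by (intro card_mono) auto
  also have "\<dots> \<le> (\<Sum>Ls\<in>MOLS m n. card ((\<lambda>L. Ls @ [L]) ` {L. Ls @ [L] \<in> MOLS (Suc m) n}))"
    by (rule card_UN_le[OF finite_MOLS])
  also have "\<dots> = (\<Sum>Ls\<in>MOLS m n. card {L. Ls @ [L] \<in> MOLS (Suc m) n})"
    by (intro sum.cong refl card_image inj)
  finally have "real (num_MOLS (Suc m) n) \<le> real (\<Sum>Ls\<in>MOLS m n. card {L. Ls @ [L] \<in> MOLS (Suc m) n})"
    unfolding num_MOLS_def of_nat_le_iff .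
  also have "\<dots> = (\<Sum>Ls\<in>MOLS m n. real (card {L. Ls @ [L] \<in> MOLS (Suc m) n}))" by simp
  also have "\<dots> \<le> (\<Sum>Ls\<in>MOLS m n. B)" by (intro sum_mono ext)
  finally show ?thesis by (simp add: num_MOLS_def)
qed

section \<open>The integral bound for one extension step\<close>

text \<open>Monotonicity yields integrability as well as the comparison on each interval. The left
  sums serve to pass from discrete labels to an integral over \<open>[0, 1]\<close>, the right sums
  to add up the levels.\<close>

lemma riemann_sum_mono_bounds:
  fixes h :: "real \<Rightarrow> real"
  assumes \<delta>: "\<delta> > 0" and h: "mono_on {0..real m * \<delta>} h"
  shows "\<delta> * (\<Sum>i<m. h (real i * \<delta>)) \<le> integral {0..real m * \<delta>} h
    \<and> integral {0..real m * \<delta>} h \<le> \<delta> * (\<Sum>i<m. h (real (Suc i) * \<delta>))"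
  using h
proof (induction m)
  case (Suc m)
  let ?a = "real m * \<delta>" and ?b = "real (Suc m) * \<delta>"
  have ab: "0 \<le> ?a" "?a \<le> ?b" "?b - ?a = \<delta>" using \<delta> by (auto simp: algebra_simps)
  have mono: "mono_on {0..?a} h" using Suc.prems ab(2) by (auto intro: mono_on_subset)
  have int: "h integrable_on {0..?b}" by (rule integrable_on_mono_on[OF Suc.prems])
  have "h integrable_on {?a..?b}"
    using integrable_on_subinterval[OF int, of ?a ?b] ab by auto
  then have hi: "(h has_integral integral {?a..?b} h) {?a..?b}" by (rule integrable_integral)
  have bounds: "h ?a \<le> h x \<and> h x \<le> h ?b" if "x \<in> {?a..?b}" for x
  proof -
    have x: "?a \<le> x" "x \<le> ?b" using that by auto
    then have "0 \<le> x" "0 \<le> ?b" using ab by linarith+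
    then show ?thesis using mono_onD[OF Suc.prems] ab(1,2) x by (simp del: of_nat_Suc)
  qed
  have "((\<lambda>_. h ?a) has_integral \<delta> * h ?a) {?a..?b}"
    using has_integral_const_real[of "h ?a" ?a ?b] ab by simp
  then have l: "\<delta> * h ?a \<le> integral {?a..?b} h"
    by (rule has_integral_le[OF _ hi]) (use bounds in blast)
  have "((\<lambda>_. h ?b) has_integral \<delta> * h ?b) {?a..?b}"
    using has_integral_const_real[of "h ?b" ?a ?b] ab by simp
  then have u: "integral {?a..?b} h \<le> \<delta> * h ?b"
    by (rule has_integral_le[OF hi]) (use bounds in blast)
  have comb: "integral {0..?a} h + integral {?a..?b} h = integral {0..?b} h"
    by (rule Henstock_Kurzweil_Integration.integral_combine[OF ab(1,2) int])
  show ?case using Suc.IH[OF mono] l u comb by (simp add: distrib_left del: of_nat_Suc)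
qed simp_all

text \<open>Here \<open>d\<close> counts the parallel classes of the net. The main term is
  \<open>ln n - d (1 - n powr (- 1 / d))\<close>; the summand with \<open>2 / (d - 1)\<close>
  absorbs the errors of the integral estimate from both sides of its breakpoint.\<close>

definition level_bound :: "nat \<Rightarrow> nat \<Rightarrow> real" where
  "level_bound n d = ln n - real d + (real d + 2 / (real d - 1)) * n powr (- 1 / real d)"

text \<open>The integrand is estimated by \<open>n t\<^sup>d\<close> below the breakpoint \<open>n powr (- 1 / d)\<close>, where
  \<open>n t\<^sup>d = 1\<close>, and by \<open>ln (n t\<^sup>d) + 1 / (n t\<^sup>d)\<close> above it.\<close>

lemma integral_ln_le_level_bound:
  assumes n: "n \<ge> 1" and d: "d \<ge> 2"
  shows "integral {0..1} (\<lambda>t. ln (1 + (real n - 1) * t ^ d)) \<le> level_bound n d"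
proof -
  let ?h = "\<lambda>t::real. ln (1 + (real n - 1) * t ^ d)"
  define N where "N = real n"
  have N: "N \<ge> 1" using n by (simp add: N_def)
  define c where "c = N powr (- 1 / real d)"
  have c0: "0 < c" using N by (simp add: c_def)
  have "c \<le> N powr 0" unfolding c_def using N by (intro powr_mono) auto
  then have c1: "c \<le> 1" using N by simp
  have Nc: "N * c ^ d = 1"
  proof -
    have "c ^ d = N powr (real d * (- 1 / real d))" unfolding c_def using N by (intro powr_power) simp
    then show ?thesis using N d by (simp add: powr_minus_divide)
  qed
  have lnc: "real d * ln c = - ln N" using d by (simp add: c_def ln_powr)
  \<comment> \<open>The antiderivative of \<open>1 / (N * t ^ d)\<close> has exponent
    \<open>1 - d\<close>; with \<open>d = e + 2\<close> it involves the inverse of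
    \<open>t ^ Suc e\<close>.\<close>
  obtain e where e: "d = Suc (Suc e)" using d by (metis Suc_le_D numeral_2_eq_2 Suc_le_mono)
  have pos: "1 + (N - 1) * t ^ d > 0" if "t \<ge> 0" for t
    using N that by (intro add_pos_nonneg mult_nonneg_nonneg) auto
  have cont: "continuous_on {0..1} ?h"
    unfolding N_def[symmetric] using pos by (intro continuous_intros) (auto simp: less_imp_neq[symmetric])
  have int: "?h integrable_on {0..1}" by (rule integrable_continuous_real[OF cont])
  have sub: "(?h has_integral integral {a..b} ?h) {a..b}" if "0 \<le> a" "b \<le> 1" for a b
    using integrable_on_subinterval[OF int, of a b] that by (auto intro: integrable_integral)
  define P1 where "P1 t = N * t ^ Suc d / real (Suc d)" for t
  define P2 where "P2 t = t * ln N + real d * (t * ln t - t) - inverse (t ^ Suc e) / (N * real (Suc e))" for t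
  have "((\<lambda>t. N * t ^ d) has_integral P1 c - P1 0) {0..c}"
  proof (rule fundamental_theorem_of_calculus)
    fix t
    show "(P1 has_vector_derivative N * t ^ d) (at t within {0..c})"
      unfolding P1_def has_real_derivative_iff_has_vector_derivative[symmetric]
      by (rule derivative_eq_intros refl | simp del: of_nat_Suc power_Suc)+
  qed (use c0 in simp)
  moreover have "?h t \<le> N * t ^ d" if "t \<in> {0..c}" for t
  proof -
    have "ln (1 + (N - 1) * t ^ d) \<le> (N - 1) * t ^ d"
      using that N by (intro ln_add_one_self_le_self) auto
    also have "\<dots> \<le> N * t ^ d" using that by (intro mult_right_mono) auto
    finally show ?thesis by (simp add: N_def)
  qed
  ultimately have low: "integral {0..c} ?h \<le> P1 c - P1 0"
    using has_integral_le[OF sub] c1 by simp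
  have "((\<lambda>t. ln N + real d * ln t + 1 / (N * t ^ d)) has_integral P2 1 - P2 c) {c..1}"
  proof (rule fundamental_theorem_of_calculus)
    fix t assume "t \<in> {c..1}"
    then have t: "t > 0" using c0 by simp
    have "((\<lambda>t. t * ln N + real d * (t * ln t - t)) has_real_derivative ln N + real d * ln t)
        (at t within {c..1})"
      using t by (auto intro!: derivative_eq_intros)
    moreover have "((\<lambda>t. inverse (t ^ Suc e)) has_real_derivative
        - (inverse (t ^ Suc e) * (real (Suc e) * t ^ e) * inverse (t ^ Suc e))) (at t within {c..1})"
      using t by (auto intro!: derivative_eq_intros simp del: of_nat_Suc power_Suc)
    ultimately have "(P2 has_real_derivative ln N + real d * ln t
        - (- (inverse (t ^ Suc e) * (real (Suc e) * t ^ e) * inverse (t ^ Suc e))) / (N * real (Suc e)))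
        (at t within {c..1})"
      unfolding P2_def by (intro DERIV_diff DERIV_cdivide)
    also have "ln N + real d * ln t
        - (- (inverse (t ^ Suc e) * (real (Suc e) * t ^ e) * inverse (t ^ Suc e))) / (N * real (Suc e))
        = ln N + real d * ln t + 1 / (N * t ^ d)"
      using t N by (simp add: e field_simps del: of_nat_Suc)
    finally show "(P2 has_vector_derivative ln N + real d * ln t + 1 / (N * t ^ d)) (at t within {c..1})"
      by (simp add: has_real_derivative_iff_has_vector_derivative)
  qed (use c1 in simp)
  moreover have "?h t \<le> ln N + real d * ln t + 1 / (N * t ^ d)" if "t \<in> {c..1}" for t
  proof -
    have t: "t > 0" using that c0 by simp
    then have p: "N * t ^ d > 0" using N by simp
    have "ln (1 + (N - 1) * t ^ d) \<le> ln (1 + N * t ^ d)"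
      using t pos[of t] p by (intro ln_mono) (auto intro: mult_right_mono)
    also have "1 + N * t ^ d = N * t ^ d * (1 + 1 / (N * t ^ d))" using t N by (simp add: field_simps)
    also have "ln \<dots> = ln (N * t ^ d) + ln (1 + 1 / (N * t ^ d))"
      using p by (intro ln_mult_pos) (auto intro: add_pos_pos)
    also have "\<dots> \<le> ln (N * t ^ d) + 1 / (N * t ^ d)"
      using p by (intro add_left_mono ln_add_one_self_le_self) simp
    also have "ln (N * t ^ d) = ln N + real d * ln t" using t N by (simp add: ln_mult_pos ln_realpow)
    finally show ?thesis by (simp add: N_def)
  qed
  ultimately have up: "integral {c..1} ?h \<le> P2 1 - P2 c"
    using has_integral_le[OF sub] c0 by simp
  have P1: "P1 c - P1 0 = c / real (Suc d)"
    using Nc by (simp add: P1_def mult.left_commute)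
  \<comment> \<open>By \<open>lnc\<close> the logarithms cancel at the breakpoint, so only multiples
    of \<open>c\<close> remain there.\<close>
  have "c * ln N + real d * (c * ln c - c) = c * (ln N + real d * ln c) - real d * c"
    by (simp add: algebra_simps)
  moreover have "inverse (c ^ Suc e) / (N * real (Suc e)) = c / real (Suc e)"
    using Nc c0 N by (simp add: e field_simps del: of_nat_Suc)
  ultimately have "P2 c = - real d * c - c / real (Suc e)" using lnc by (simp add: P2_def)
  moreover have "P2 1 \<le> ln N - real d" using N by (simp add: P2_def)
  moreover have "c / real (Suc d) \<le> c / real (Suc e)"
    using c0 e by (intro divide_left_mono) auto
  ultimately have "P1 c - P1 0 + (P2 1 - P2 c) \<le> ln N - real d + real d * c + 2 * (c / real (Suc e))"
    unfolding P1 by simp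
  also have "\<dots> = level_bound n d"
    unfolding level_bound_def N_def[symmetric] c_def[symmetric] by (simp add: e algebra_simps)
  finally show ?thesis
    using low up Henstock_Kurzweil_Integration.integral_combine[OF less_imp_le[OF c0] c1 int] by linarith
qed

text \<open>The sum over right endpoints exceeds the one over left endpoints by a telescoping
  \<open>(h 1 - h 0) / M\<close>, and for this integrand \<open>h 1 - h 0 = ln n\<close>.\<close>

lemma riemann_sum_ln_le:
  assumes n: "n \<ge> 1" and d: "d \<ge> 2" and M: "M > 0"
  shows "(\<Sum>s=1..M. ln (1 + (real n - 1) * (real s / real M) ^ d)) / real M
    \<le> level_bound n d + ln (real n) / real M"
proof -
  let ?h = "\<lambda>t::real. ln (1 + (real n - 1) * t ^ d)"
  have "mono_on {0..real M * (1 / real M)} ?h"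
  proof (rule mono_onI)
    fix s t assume "s \<in> {0..real M * (1 / real M)}" "s \<le> t"
    then have "(real n - 1) * s ^ d \<le> (real n - 1) * t ^ d" "0 \<le> (real n - 1) * s ^ d"
      using n by (auto intro!: mult_left_mono power_mono)
    then show "?h s \<le> ?h t" by (intro ln_mono) auto
  qed
  then have "1 / real M * (\<Sum>i<M. ?h (real i * (1 / real M))) \<le> integral {0..real M * (1 / real M)} ?h"
    using M by (intro riemann_sum_mono_bounds[THEN conjunct1]) auto
  also have "\<dots> \<le> level_bound n d" using integral_ln_le_level_bound[OF n d] M by simp
  finally have *: "(\<Sum>i<M. ?h (real i / real M)) / real M \<le> level_bound n d" by simp
  have "(\<Sum>s=1..M. ?h (real s / real M)) = (\<Sum>i<M. ?h (real (Suc i) / real M))"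
    using sum.atLeast1_atMost_eq[of "\<lambda>s. ?h (real s / real M)" M] by simp
  also have "\<dots> = (\<Sum>i<M. ?h (real i / real M)) + (?h (real M / real M) - ?h (real 0 / real M))"
    using sum_lessThan_telescope[of "\<lambda>i. ?h (real i / real M)" M] by (simp add: sum_subtractf)
  also have "?h (real M / real M) - ?h (real 0 / real M) = ln (real n)"
    using M d by (simp add: zero_power)
  finally show ?thesis using * by (simp add: add_divide_distrib)
qed

section \<open>The number of MOLS as a product over levels\<close>

lemma ln_num_MOLS_le_level_bounds:
  assumes n: "n \<ge> 1" and pos: "num_MOLS k n > 0"
  shows "ln (real (num_MOLS k n)) \<le> (real n)\<^sup>2 * (\<Sum>i<k. level_bound n (i + 2))"
proof -
  have ext: "real (card {L. Ls @ [L] \<in> MOLS (Suc m) n}) \<le> exp ((real n)\<^sup>2 * level_bound n (m + 2))"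
    (is "real (card ?F) \<le> _") if Ls: "Ls \<in> MOLS m n" for Ls m
  proof (cases "card ?F = 0")
    case False
    then have ne: "?F \<noteq> {}" by (metis card.empty)
    have le: "ln (real (card ?F)) \<le> (real n)\<^sup>2 * (level_bound n (m + 2) + ln (real n) / real (Suc M))" for M
    proof -
      have "ln (real (card ?F)) \<le> (real n)\<^sup>2 *
          ((\<Sum>s=1..Suc M. ln (1 + (real n - 1) * (real s / real (Suc M)) ^ (m + 2))) / real (Suc M))"
        by (rule ln_card_extensions_le[OF Ls _ refl ne]) simp
      also have "\<dots> \<le> (real n)\<^sup>2 * (level_bound n (m + 2) + ln (real n) / real (Suc M))"
        by (intro mult_left_mono riemann_sum_ln_le n) auto
      finally show ?thesis .
    qed
    \<comment> \<open>The left side of \<open>le\<close> does not involve \<open>M\<close>, so the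
      discretisation error disappears as \<open>M\<close> grows.\<close>
    have "(\<lambda>M. (real n)\<^sup>2 * (level_bound n (m + 2) + ln (real n) * inverse (real (Suc M))))
        \<longlonglongrightarrow> (real n)\<^sup>2 * (level_bound n (m + 2) + ln (real n) * 0)"
      by (intro tendsto_intros LIMSEQ_inverse_real_of_nat)
    then have "ln (real (card ?F)) \<le> (real n)\<^sup>2 * (level_bound n (m + 2) + ln (real n) * 0)"
      by (rule LIMSEQ_le_const) (use le in \<open>simp add: divide_inverse\<close>)
    then have "exp (ln (real (card ?F))) \<le> exp ((real n)\<^sup>2 * level_bound n (m + 2))" by simp
    then show ?thesis using False by simp
  qed simp
  \<comment> \<open>The induction bounds the count and not its logarithm, so that levels with count
    0 need no separate treatment.\<close>
  have "real (num_MOLS k n) \<le> exp ((real n)\<^sup>2 * (\<Sum>i<k. level_bound n (i + 2)))"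
  proof (induction k)
    case 0
    have "MOLS 0 n = {[]}" by (auto simp: MOLS_def)
    then show ?case by (simp add: num_MOLS_def)
  next
    case (Suc k)
    have "real (num_MOLS (Suc k) n) \<le> real (num_MOLS k n) * exp ((real n)\<^sup>2 * level_bound n (k + 2))"
      by (intro num_MOLS_Suc_le ext) auto
    also have "\<dots> \<le> exp ((real n)\<^sup>2 * (\<Sum>i<k. level_bound n (i + 2))) * exp ((real n)\<^sup>2 * level_bound n (k + 2))"
      by (intro mult_right_mono Suc.IH) auto
    also have "\<dots> = exp ((real n)\<^sup>2 * (\<Sum>i<Suc k. level_bound n (i + 2)))"
      by (simp add: exp_add[symmetric] distrib_left)
    finally show ?case .
  qed
  then show ?thesis using pos by (metis ln_exp ln_mono of_nat_0_less_iff)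
qed

section \<open>The limiting profile and its integral\<close>

text \<open>The integrand of \<open>mols_const\<close>; the factor \<open>x\<close> makes it vanish
  at 0, whatever \<open>1 / 0\<close> is.\<close>

definition profile :: "real \<Rightarrow> real" where
  "profile x = x * (1 - exp (- 1 / x))"

lemma profile_nonneg: "x \<ge> 0 \<Longrightarrow> 0 \<le> profile x"
  unfolding profile_def by (intro mult_nonneg_nonneg) auto

lemma profile_le_1: "x \<ge> 0 \<Longrightarrow> profile x \<le> 1"
proof (cases "x = 0")
  case False
  assume "x \<ge> 0"
  moreover have "1 + (- 1 / x) \<le> exp (- 1 / x)" by (rule exp_ge_add_one_self)
  ultimately have "x * (1 - exp (- 1 / x)) \<le> x * (1 / x)" by (intro mult_left_mono) auto
  then show ?thesis using False by (simp add: profile_def)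
qed (simp add: profile_def)

text \<open>With \<open>u = 1 / x\<close> this is
  \<open>exp (- u) \<le> 1 - u + u\<^sup>2 / 2\<close>. Its integral over \<open>[1, y]\<close>
  falls short of \<open>y - 1\<close> by \<open>ln y / 2\<close>, the origin of the constant 1/2 for
  large \<open>k\<close>.\<close>

lemma profile_ge:
  assumes x: "x > 0"
  shows "1 - 1 / (2 * x) \<le> profile x"
proof -
  define u where "u = 1 / x"
  have u: "u > 0" using x by (simp add: u_def)
  \<comment> \<open>The product equals \<open>1 + u ^ 4 / 4\<close>.\<close>
  have "1 \<le> (1 - u + u\<^sup>2 / 2) * (1 + u + u\<^sup>2 / 2)"
    using u by (simp add: power2_eq_square algebra_simps)
  also have "\<dots> \<le> (1 - u + u\<^sup>2 / 2) * exp u"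
  proof (intro mult_left_mono exp_lower_Taylor_quadratic)
    have "0 \<le> ((1 - u)\<^sup>2 + 1) / 2" by simp
    also have "\<dots> = 1 - u + u\<^sup>2 / 2" by (simp add: power2_eq_square field_simps)
    finally show "0 \<le> 1 - u + u\<^sup>2 / 2" .
  qed (use u in simp)
  finally have "exp (- u) \<le> 1 - u + u\<^sup>2 / 2" by (simp add: exp_minus field_simps)
  then have "x * (u - u\<^sup>2 / 2) \<le> x * (1 - exp (- u))" using x by (intro mult_left_mono) auto
  moreover have "x * (u - u\<^sup>2 / 2) = 1 - 1 / (2 * x)"
    using x by (simp add: u_def power2_eq_square field_simps)
  ultimately show ?thesis by (simp add: profile_def u_def)
qed

text \<open>The derivative \<open>1 - exp (- 1 / z) * (1 + 1 / z)\<close> is nonnegative because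
  \<open>1 + u \<le> exp u\<close>. Monotonicity up to the endpoint 0 gives integrability and the
  comparison with Riemann sums.\<close>

lemma profile_mono: "mono_on {0..} profile"
proof (rule mono_onI)
  fix x y :: real assume "x \<in> {0..}" "y \<in> {0..}" "x \<le> y"
  then have xy: "0 \<le> x" "x \<le> y" by auto
  show "profile x \<le> profile y"
  proof (cases "x = 0")
    case True
    then show ?thesis using profile_nonneg[of y] xy by (simp add: profile_def)
  next
    case False
    show ?thesis
    proof (rule DERIV_nonneg_imp_nondecreasing[OF xy(2)])
      fix z assume "x \<le> z" "z \<le> y"
      then have z: "z > 0" using xy False by simp
      have "(profile has_real_derivative 1 - exp (- 1 / z) * (1 + 1 / z)) (at z)"
        unfolding profile_def using z
        by (auto intro!: derivative_eq_intros simp: field_simps power2_eq_square)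
      moreover have "exp (- 1 / z) * (1 + 1 / z) \<le> exp (- 1 / z) * exp (1 / z)"
        by (intro mult_left_mono exp_ge_add_one_self) auto
      then have "0 \<le> 1 - exp (- 1 / z) * (1 + 1 / z)" by (simp add: exp_add[symmetric])
      ultimately show "\<exists>d. (profile has_real_derivative d) (at z) \<and> 0 \<le> d" by blast
    qed
  qed
qed

lemma profile_integrable: "0 \<le> a \<Longrightarrow> profile integrable_on {a..b}"
  by (rule integrable_on_mono_on, rule mono_on_subset[OF profile_mono]) auto

definition profile_integral :: "real \<Rightarrow> real" where
  "profile_integral y = integral {0..y} profile"

text \<open>Holds since the profile lies in \<open>[0, 1]\<close>. It places
  \<open>mols_const\<close> in the unit interval and makes the integral 1-Lipschitz, hence
  continuous in its endpoint.\<close>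

lemma profile_integral_diff:
  assumes "0 \<le> a" "a \<le> b"
  shows "0 \<le> profile_integral b - profile_integral a" "profile_integral b - profile_integral a \<le> b - a"
proof -
  have eq: "profile_integral b - profile_integral a = integral {a..b} profile"
    using Henstock_Kurzweil_Integration.integral_combine[OF assms profile_integrable[of 0 b]]
    by (simp add: profile_integral_def)
  have hi: "(profile has_integral integral {a..b} profile) {a..b}"
    by (intro integrable_integral profile_integrable assms)
  show "0 \<le> profile_integral b - profile_integral a" unfolding eq
    by (rule has_integral_nonneg[OF hi]) (use assms in \<open>auto intro: profile_nonneg\<close>)
  have "((\<lambda>_. 1) has_integral (b - a)) {a..b}"
    using has_integral_const_real[of "1::real" a b] assms by simp
  then show "profile_integral b - profile_integral a \<le> b - a" unfolding eq
    by (rule has_integral_le[OF hi]) (use assms in \<open>auto intro: profile_le_1\<close>)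
qed

lemma profile_integral_0 [simp]: "profile_integral 0 = 0"
  by (simp add: profile_integral_def)

text \<open>The deficit \<open>1 - profile\<close> contributes at most 1 on \<open>[0, 1]\<close>
  and, by \<open>profile_ge\<close>, at most \<open>ln y / 2\<close> on
  \<open>[1, y]\<close>.\<close>

lemma profile_integral_ge_ln:
  assumes y: "y \<ge> 1"
  shows "y - profile_integral y \<le> 1 + ln y / 2"
proof -
  have eq: "profile_integral y = profile_integral 1 + integral {1..y} profile"
    using Henstock_Kurzweil_Integration.integral_combine[OF _ y profile_integrable[of 0 y]]
    by (simp add: profile_integral_def)
  have "((\<lambda>x. 1 - 1 / (2 * x)) has_integral (y - ln y / 2) - (1 - ln 1 / 2)) {1..y}"
  proof (rule fundamental_theorem_of_calculus[OF y])
    fix x assume "x \<in> {1..y}"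
    then show "((\<lambda>x. x - ln x / 2) has_vector_derivative 1 - 1 / (2 * x)) (at x within {1..y})"
      unfolding has_real_derivative_iff_has_vector_derivative[symmetric]
      by (auto intro!: derivative_eq_intros)
  qed
  then have "(y - ln y / 2) - (1 - ln 1 / 2) \<le> integral {1..y} profile"
    by (rule has_integral_le[OF _ integrable_integral[OF profile_integrable]])
      (use profile_ge in auto)
  then show ?thesis using eq profile_integral_diff(1)[of 0 1] by simp
qed

lemma mols_const_eq: "mols_const \<beta> = 1 - profile_integral \<beta> / \<beta>"
  by (simp add: mols_const_def profile_integral_def profile_def[abs_def] divide_inverse mult.commute)

section \<open>Summing the level bounds\<close>

text \<open>With \<open>l = ln n\<close>, level \<open>d = i + 2\<close> saves
  \<open>l * profile (d / l)\<close>. Lowering the sample point to \<open>(i + 1) / l\<close> turns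
  the total into a right Riemann sum of mesh \<open>1 / l\<close> over exactly
  \<open>[0, k / l]\<close>.\<close>

lemma sum_level_bound_le:
  assumes n: "n \<ge> 2"
  shows "(\<Sum>i<k. level_bound n (i + 2)) \<le>
    real k * ln n - (ln n)\<^sup>2 * profile_integral (real k / ln n) + (\<Sum>i<k. 2 / (real i + 1))"
proof -
  define l where "l = ln (real n)"
  have l: "l > 0" using n by (simp add: l_def)
  have each: "level_bound n (i + 2) \<le> l - l * profile (real (Suc i) * (1 / l)) + 2 / (real i + 1)" for i
  proof -
    let ?d = "real (i + 2)"
    have p: "real n powr (- 1 / ?d) = exp (- 1 / (?d / l))" using n by (simp add: powr_def l_def)
    have "l * profile (?d / l) = ?d * (1 - exp (- 1 / (?d / l)))"
      using l by (simp add: profile_def)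
    then have "level_bound n (i + 2) = l - l * profile (?d / l) + 2 / (real i + 1) * exp (- 1 / (?d / l))"
      unfolding level_bound_def p by (simp add: l_def[symmetric] algebra_simps)
    also have "\<dots> \<le> l - l * profile (real (Suc i) * (1 / l)) + 2 / (real i + 1) * 1"
    proof (intro add_mono diff_mono mult_left_mono order.refl)
      show "profile (real (Suc i) * (1 / l)) \<le> profile (?d / l)"
        using l by (intro mono_onD[OF profile_mono]) (auto intro: divide_right_mono)
    qed (use l in auto)
    finally show ?thesis by simp
  qed
  have "integral {0..real k * (1 / l)} profile \<le> 1 / l * (\<Sum>i<k. profile (real (Suc i) * (1 / l)))"
    by (rule riemann_sum_mono_bounds[THEN conjunct2])
      (use l in \<open>auto intro: mono_on_subset[OF profile_mono]\<close>)
  then have "l\<^sup>2 * integral {0..real k * (1 / l)} profile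
      \<le> l\<^sup>2 * (1 / l * (\<Sum>i<k. profile (real (Suc i) * (1 / l))))"
    by (intro mult_left_mono) auto
  then have R: "l\<^sup>2 * profile_integral (real k / l) \<le> l * (\<Sum>i<k. profile (real (Suc i) * (1 / l)))"
    using l by (simp add: profile_integral_def power2_eq_square del: of_nat_Suc)
  have "(\<Sum>i<k. level_bound n (i + 2))
      \<le> (\<Sum>i<k. l - l * profile (real (Suc i) * (1 / l)) + 2 / (real i + 1))"
    by (rule sum_mono[OF each])
  also have "\<dots> = real k * l - l * (\<Sum>i<k. profile (real (Suc i) * (1 / l))) + (\<Sum>i<k. 2 / (real i + 1))"
    by (simp add: sum.distrib sum_subtractf sum_distrib_left del: of_nat_Suc)
  finally show ?thesis using R unfolding l_def[symmetric] by linarith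
qed

lemma sum_inverse_le_ln:
  assumes "k \<ge> 1"
  shows "(\<Sum>i<k. 2 / (real i + 1)) \<le> 2 + 2 * ln (real k)"
  using assms
proof (induction k rule: dec_induct)
  case (step k)
  have "ln (real k / (real k + 1)) \<le> real k / (real k + 1) - 1"
    using step by (intro ln_le_minus_one) auto
  also have "\<dots> = - 1 / (real k + 1)" by (simp add: field_simps)
  finally have "1 / (real k + 1) \<le> ln (real (Suc k)) - ln (real k)"
    using step by (simp add: ln_div add.commute)
  then show ?case using step by simp
qed simp

text \<open>For \<open>k \<ge> 7\<close> the polynomial factor alone suffices; for smaller \<open>k\<close> the two exponents differ by
  \<open>1 / ((k + 1) (k + 2)) \<ge> 1 / 72\<close>, whence the threshold.\<close>

lemma level_bound_error_le:
  fixes n k :: nat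
  assumes n: "n \<ge> 4 ^ 72"
  shows "((real k)\<^sup>2 + 7 * real k) / 2 * n powr (- 1 / (real k + 1))
    \<le> (real k)\<^sup>2 * n powr (- 1 / (real k + 2))"
proof (cases "k \<ge> 7")
  case True
  have n1: "real n \<ge> 1" using order_trans[OF _ n, of 1] by simp
  have "7 * real k \<le> real k * real k" using True by (intro mult_right_mono) auto
  then have "((real k)\<^sup>2 + 7 * real k) / 2 \<le> (real k)\<^sup>2" by (simp add: power2_eq_square)
  moreover have "n powr (- 1 / (real k + 1)) \<le> n powr (- 1 / (real k + 2))"
    using n1 by (intro powr_mono) (auto simp: field_simps)
  ultimately show ?thesis by (intro mult_mono) auto
next
  case False
  have n1: "real n \<ge> 1" using order_trans[OF _ n, of 1] by simp
  have "real ((k + 1) * (k + 2)) \<le> real (8 * 9)"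
    using False by (intro of_nat_mono mult_mono) auto
  then have q: "(real k + 1) * (real k + 2) \<le> 72" by (simp add: algebra_simps)
  have "(b ^ 72) powr (1 / 72) = b" if "b > 0" for b :: real
    using powr_powr[of b 72 "1 / 72"] that by simp
  from this[of 4] have "(4::real) = (4 ^ 72) powr (1 / 72)" by (simp only: zero_less_numeral)
  also have "\<dots> \<le> n powr (1 / 72)"
  proof (intro powr_mono2)
    have "real (4 ^ 72) \<le> real n" using n by (rule of_nat_mono)
    then show "(4::real) ^ 72 \<le> real n" by (simp only: of_nat_power of_nat_numeral)
  qed simp_all
  also have "\<dots> \<le> n powr (1 / ((real k + 1) * (real k + 2)))"
    using n1 q by (intro powr_mono divide_left_mono) auto
  finally have "4 * n powr (- 1 / (real k + 1))
      \<le> n powr (1 / ((real k + 1) * (real k + 2))) * n powr (- 1 / (real k + 1))"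
    by (intro mult_right_mono) auto
  also have "\<dots> = n powr (1 / ((real k + 1) * (real k + 2)) + (- 1 / (real k + 1)))"
    by (rule powr_add[symmetric])
  also have "1 / ((real k + 1) * (real k + 2)) + (- 1 / (real k + 1)) = - 1 / (real k + 2)"
  proof -
    have "1 / (real k + 1) - 1 / (real k + 2) = 1 / ((real k + 1) * (real k + 2))"
      by (subst diff_frac_eq) auto
    then show ?thesis by simp
  qed
  finally have four: "4 * n powr (- 1 / (real k + 1)) \<le> n powr (- 1 / (real k + 2))" .
  \<comment> \<open>For natural \<open>k\<close> the coefficient is at most
    \<open>4 * k\<^sup>2\<close>; this 4 is the base of the threshold.\<close>
  have "real k \<le> real (k * k)" by (rule of_nat_mono[OF le_square])
  then have "((real k)\<^sup>2 + 7 * real k) / 2 \<le> 4 * (real k)\<^sup>2" by (simp add: power2_eq_square)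
  then have "((real k)\<^sup>2 + 7 * real k) / 2 * n powr (- 1 / (real k + 1))
      \<le> 4 * (real k)\<^sup>2 * n powr (- 1 / (real k + 1))" by (intro mult_right_mono) auto
  also have "\<dots> = (real k)\<^sup>2 * (4 * n powr (- 1 / (real k + 1)))" by simp
  also have "\<dots> \<le> (real k)\<^sup>2 * n powr (- 1 / (real k + 2))" by (intro mult_left_mono four) auto
  finally show ?thesis .
qed

text \<open>For \<open>i < k\<close> every power of \<open>n\<close> is at most
  \<open>n powr (- 1 / (k + 1))\<close>, and its coefficient is at most \<open>i + 4\<close>.
  Summing these coefficients gives the left side of \<open>level_bound_error_le\<close>, which then
  trades \<open>k + 1\<close> for \<open>k + 2\<close> in the exponent.\<close>

lemma sum_level_bound_le_choose:
  fixes n k :: nat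
  assumes n: "n \<ge> 4 ^ 72"
  shows "(\<Sum>i<k. level_bound n (i + 2)) \<le>
    real k * ln n - real ((k + 2) choose 2) + 1 + (real k)\<^sup>2 * n powr (- 1 / (real k + 2))"
proof -
  have n1: "real n \<ge> 1" using order_trans[OF _ n, of 1] by simp
  let ?p = "n powr (- 1 / (real k + 1))"
  have each: "level_bound n (i + 2) \<le> ln n - real (i + 2) + (real i + 4) * ?p" if "i < k" for i
  proof -
    have "real (i + 2) + 2 / (real (i + 2) - 1) \<le> real i + 4" by (simp add: field_simps)
    moreover have "n powr (- 1 / real (i + 2)) \<le> ?p"
      using n1 that by (intro powr_mono) (auto simp: field_simps)
    ultimately have "(real (i + 2) + 2 / (real (i + 2) - 1)) * n powr (- 1 / real (i + 2))
        \<le> (real i + 4) * ?p" by (intro mult_mono) auto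
    then show ?thesis by (simp add: level_bound_def)
  qed
  have choose: "(\<Sum>i<k. real (i + 2)) = real ((k + 2) choose 2) - 1"
    by (induction k) (auto simp: numeral_2_eq_2)
  have lin: "(\<Sum>i<k. real i + 4) = ((real k)\<^sup>2 + 7 * real k) / 2"
    by (induction k) (auto simp: power2_eq_square field_simps)
  have "(\<Sum>i<k. level_bound n (i + 2)) \<le> (\<Sum>i<k. ln n - real (i + 2) + (real i + 4) * ?p)"
    using each by (intro sum_mono) auto
  also have "\<dots> = (\<Sum>i<k. ln n - real (i + 2)) + (\<Sum>i<k. (real i + 4) * ?p)" by (rule sum.distrib)
  also have "\<dots> = (real k * ln n - (\<Sum>i<k. real (i + 2))) + (\<Sum>i<k. real i + 4) * ?p"
    by (simp only: sum_subtractf sum_constant card_lessThan sum_distrib_right)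
  finally show ?thesis using level_bound_error_le[OF n, of k] unfolding choose lin by linarith
qed

section \<open>The three regimes\<close>

lemma mols_const_in_unit_interval: "\<beta> > 0 \<Longrightarrow> mols_const \<beta> \<in> {0..1}"
  using profile_integral_diff[of 0 \<beta>] by (simp add: mols_const_eq field_simps)

lemma profile_integral_tendsto:
  assumes y: "(y \<longlongrightarrow> \<beta>) F" and "\<And>n. y n \<ge> 0" "\<beta> \<ge> 0"
  shows "((\<lambda>n. profile_integral (y n)) \<longlongrightarrow> profile_integral \<beta>) F"
proof -
  have "\<forall>n. norm (profile_integral (y n) - profile_integral \<beta>) \<le> norm (y n - \<beta>)"
  proof
    fix n
    show "norm (profile_integral (y n) - profile_integral \<beta>) \<le> norm (y n - \<beta>)"
      using profile_integral_diff[of "y n" \<beta>] profile_integral_diff[of \<beta> "y n"] assms(2)[of n] assms(3)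
      by (cases "y n \<le> \<beta>") auto
  qed
  then have "((\<lambda>n. profile_integral (y n) - profile_integral \<beta>) \<longlongrightarrow> 0) F"
    by (rule Lim_null_comparison[OF always_eventually tendsto_norm_zero[OF LIM_zero[OF y]]])
  then show ?thesis by (rule LIM_zero_cancel)
qed

theorem corollary4:
  fixes k :: "nat \<Rightarrow> nat"
  shows
    "((\<lambda>n. real (k n)) \<in> o(\<lambda>n. ln (real n)) \<longrightarrow>
       (\<forall>\<^sub>F n in sequentially. num_MOLS (k n) n > 0 \<longrightarrow>
          ln (real (num_MOLS (k n) n)) \<le>
            (real (k n) * ln (real n) - real ((k n + 2) choose 2) + 1
              + (real (k n))\<^sup>2 * real n powr (- 1 / (real (k n) + 2))) * (real n)\<^sup>2))
     \<and>
     (\<forall>\<beta>>0.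
       mols_const \<beta> \<in> {0..1} \<and>
       ((\<lambda>n. real (k n)) \<sim>[sequentially] (\<lambda>n. \<beta> * ln (real n)) \<longrightarrow>
         (\<exists>\<epsilon> :: nat \<Rightarrow> real. \<epsilon> \<longlonglongrightarrow> 0 \<and>
           (\<forall>\<^sub>F n in sequentially. num_MOLS (k n) n > 0 \<longrightarrow>
              ln (real (num_MOLS (k n) n)) \<le>
                (mols_const \<beta> + \<epsilon> n) * real (k n) * (real n)\<^sup>2 * ln (real n)))))
     \<and>
     ((\<lambda>n. real (k n)) \<in> \<omega>(\<lambda>n. ln (real n)) \<longrightarrow>
       (\<exists>\<epsilon> :: nat \<Rightarrow> real. \<epsilon> \<longlonglongrightarrow> 0 \<and>
         (\<forall>\<^sub>F n in sequentially. num_MOLS (k n) n > 0 \<longrightarrow>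
            ln (real (num_MOLS (k n) n)) \<le>
              (1 / 2 + \<epsilon> n) * (ln (real (k n)) - ln (ln (real n)))
                * (real n)\<^sup>2 * (ln (real n))\<^sup>2)))"
proof (intro conjI impI allI)
  show "\<forall>\<^sub>F n in sequentially. num_MOLS (k n) n > 0 \<longrightarrow>
      ln (real (num_MOLS (k n) n)) \<le>
        (real (k n) * ln (real n) - real ((k n + 2) choose 2) + 1
          + (real (k n))\<^sup>2 * real n powr (- 1 / (real (k n) + 2))) * (real n)\<^sup>2"
    using eventually_ge_at_top[of "4 ^ 72"]
  proof eventually_elim
    case (elim n)
    have "n \<ge> 1" using order_trans[OF _ elim, of 1] by simp
    show ?case
    proof
      assume "num_MOLS (k n) n > 0"
      then have "ln (real (num_MOLS (k n) n)) \<le> (real n)\<^sup>2 * (\<Sum>i<k n. level_bound n (i + 2))"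
        by (rule ln_num_MOLS_le_level_bounds[OF \<open>n \<ge> 1\<close>])
      also have "\<dots> \<le> (real n)\<^sup>2 * (real (k n) * ln (real n) - real ((k n + 2) choose 2) + 1
          + (real (k n))\<^sup>2 * real n powr (- 1 / (real (k n) + 2)))"
        by (intro mult_left_mono sum_level_bound_le_choose elim) simp
      finally show "ln (real (num_MOLS (k n) n)) \<le>
        (real (k n) * ln (real n) - real ((k n + 2) choose 2) + 1
          + (real (k n))\<^sup>2 * real n powr (- 1 / (real (k n) + 2))) * (real n)\<^sup>2"
        by (simp only: mult.commute)
    qed
  qed
next
  fix \<beta> :: real assume \<beta>: "0 < \<beta>"
  then show "mols_const \<beta> \<in> {0..1}" by (rule mols_const_in_unit_interval)
  assume k: "(\<lambda>n. real (k n)) \<sim>[sequentially] (\<lambda>n. \<beta> * ln (real n))"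
  define y where "y n = real (k n) / ln (real n)" for n
  have ln_pos: "\<forall>\<^sub>F n in sequentially. ln (real n) > 0"
    using eventually_ge_at_top[of 2] by eventually_elim simp
  have "(\<lambda>n. real (k n) / (\<beta> * ln (real n))) \<longlonglongrightarrow> 1"
    by (rule asymp_equivD_strong[OF k]) (use ln_pos \<beta> in \<open>auto elim: eventually_mono\<close>)
  then have "(\<lambda>n. \<beta> * (real (k n) / (\<beta> * ln (real n)))) \<longlonglongrightarrow> \<beta> * 1" by (rule tendsto_mult_left)
  then have y: "y \<longlonglongrightarrow> \<beta>" using \<beta> by (simp add: y_def[abs_def])
  have y0: "y n \<ge> 0" for n by (cases "n = 0") (auto simp: y_def)
  \<comment> \<open>The bound below divided by \<open>k n\<^sup>2 ln n\<close>, minus the constant.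
    The part \<open>2 / ln n\<close> stems from estimating each of the \<open>k\<close> error terms
    by 2.\<close>
  define \<epsilon> where "\<epsilon> n = (1 - profile_integral (y n) / y n + 2 / ln (real n)) - mols_const \<beta>" for n
  have "(\<lambda>n. (1 - profile_integral (y n) / y n + 2 / ln (real n)) - mols_const \<beta>)
      \<longlonglongrightarrow> (1 - profile_integral \<beta> / \<beta> + 0) - mols_const \<beta>"
    using \<beta> by (intro tendsto_intros profile_integral_tendsto y y0) (auto, real_asymp)
  then have "\<epsilon> \<longlonglongrightarrow> 0" by (simp add: \<epsilon>_def[abs_def] mols_const_eq)
  moreover have "\<forall>\<^sub>F n in sequentially. num_MOLS (k n) n > 0 \<longrightarrow> ln (real (num_MOLS (k n) n)) \<le>
      (mols_const \<beta> + \<epsilon> n) * real (k n) * (real n)\<^sup>2 * ln (real n)"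
    using eventually_ge_at_top[of 2]
  proof eventually_elim
    case (elim n)
    have l: "ln (real n) > 0" using elim by simp
    show ?case
    proof
      assume "num_MOLS (k n) n > 0"
      then have "ln (real (num_MOLS (k n) n)) \<le> (real n)\<^sup>2 * (\<Sum>i<k n. level_bound n (i + 2))"
        using elim by (intro ln_num_MOLS_le_level_bounds) auto
      also have "\<dots> \<le> (real n)\<^sup>2 * (real (k n) * ln n - (ln n)\<^sup>2 * profile_integral (y n)
          + (\<Sum>i<k n. 2 / (real i + 1)))"
        unfolding y_def by (intro mult_left_mono sum_level_bound_le elim) simp
      also have "\<dots> \<le> (real n)\<^sup>2 * (real (k n) * ln n - (ln n)\<^sup>2 * profile_integral (y n) + (\<Sum>i<k n. 2))"
        by (intro mult_left_mono add_left_mono sum_mono) (auto simp: field_simps)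
      also have "\<dots> = (mols_const \<beta> + \<epsilon> n) * real (k n) * (real n)\<^sup>2 * ln (real n)"
      \<comment> \<open>The rewriting divides by \<open>y n\<close>, which is 0 when
        \<open>k n = 0\<close>; then both sides are 0.\<close>
      proof (cases "k n = 0")
        case False
        then have eq1: "(ln n)\<^sup>2 * profile_integral (y n) = real (k n) * ln n * (profile_integral (y n) / y n)"
          using l by (simp add: y_def power2_eq_square)
        have eq2: "(\<Sum>i<k n. 2) = real (k n) * ln n * (2 / ln n)" using l by simp
        have "N * (K * a - K * a * b + K * a * d) = (c + ((1 - b + d) - c)) * K * N * a"
          for N K a b c d :: real by (simp add: algebra_simps)
        then show ?thesis unfolding eq1 eq2 \<epsilon>_def .
      qed (simp add: y_def)
      finally show "ln (real (num_MOLS (k n) n)) \<le>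
        (mols_const \<beta> + \<epsilon> n) * real (k n) * (real n)\<^sup>2 * ln (real n)" .
    qed
  qed
  ultimately show "\<exists>\<epsilon> :: nat \<Rightarrow> real. \<epsilon> \<longlonglongrightarrow> 0 \<and>
      (\<forall>\<^sub>F n in sequentially. num_MOLS (k n) n > 0 \<longrightarrow> ln (real (num_MOLS (k n) n)) \<le>
         (mols_const \<beta> + \<epsilon> n) * real (k n) * (real n)\<^sup>2 * ln (real n))" by blast
next
  assume k: "(\<lambda>n. real (k n)) \<in> \<omega>(\<lambda>n. ln (real n))"
  define y where "y n = real (k n) / ln (real n)" for n
  have ln_pos: "\<forall>\<^sub>F n in sequentially. ln (real n) > 0"
    using eventually_ge_at_top[of 2] by eventually_elim simp
  have y: "filterlim y at_top sequentially"
    unfolding filterlim_at_top_gt[where c = 0]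
  proof (intro allI impI)
    fix Z :: real assume "0 < Z"
    then have "\<forall>\<^sub>F n in sequentially. norm (real (k n)) \<ge> Z * norm (ln (real n))"
      by (rule landau_omega.smallD[OF k])
    with ln_pos show "\<forall>\<^sub>F n in sequentially. Z \<le> y n"
      by eventually_elim (simp add: y_def field_simps)
  qed
  have ln_y: "(\<lambda>n. 1 / ln (y n)) \<longlonglongrightarrow> 0"
    using tendsto_inverse_0_at_top[OF filterlim_compose[OF ln_at_top y]] by (simp add: inverse_eq_divide)
  \<comment> \<open>Chosen so that \<open>1 / 2 + \<epsilon> n\<close> is the final bound
    \<open>l\<^sup>2 (1 + ln y / 2) + 2 + 2 (ln y + ln l)\<close> divided by
    \<open>l\<^sup>2 ln y\<close>, with \<open>l = ln n\<close>.\<close>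
  define \<epsilon> where "\<epsilon> n = 1 / ln (y n) + (2 + 2 * ln (ln n)) / (ln n)\<^sup>2 * (1 / ln (y n)) + 2 / (ln n)\<^sup>2"
    for n :: nat
  have "(\<lambda>n::nat. (2 + 2 * ln (ln n)) / (ln n)\<^sup>2) \<longlonglongrightarrow> 0" "(\<lambda>n::nat. 2 / (ln n)\<^sup>2) \<longlonglongrightarrow> 0"
    by real_asymp+
  then have "(\<lambda>n. 1 / ln (y n) + (2 + 2 * ln (ln n)) / (ln n)\<^sup>2 * (1 / ln (y n)) + 2 / (ln n)\<^sup>2)
      \<longlonglongrightarrow> 0 + 0 * 0 + 0"
    by (intro tendsto_add tendsto_mult ln_y)
  then have "\<epsilon> \<longlonglongrightarrow> 0" by (simp add: \<epsilon>_def[abs_def])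
  \<comment> \<open>Beyond 1, \<open>ln (y n)\<close> is positive and the logarithmic estimate of
    the profile integral applies.\<close>
  moreover have "\<forall>\<^sub>F n in sequentially. y n > 1" using y by (simp add: filterlim_at_top_dense)
  then have "\<forall>\<^sub>F n in sequentially. num_MOLS (k n) n > 0 \<longrightarrow> ln (real (num_MOLS (k n) n)) \<le>
      (1 / 2 + \<epsilon> n) * (ln (real (k n)) - ln (ln (real n))) * (real n)\<^sup>2 * (ln (real n))\<^sup>2"
    using eventually_ge_at_top[of 2]
  proof eventually_elim
    case (elim n)
    define l where "l = ln (real n)"
    have l: "l > 0" using elim by (simp add: l_def)
    have k1: "k n \<ge> 1" using elim(1) by (cases "k n") (auto simp: y_def)
    have kl: "real (k n) = y n * l" using l by (simp add: y_def l_def)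
    have lnk: "ln (real (k n)) = ln (y n) + ln l" unfolding kl using l elim by (intro ln_mult_pos) auto
    have lny: "ln (y n) > 0" using elim by simp
    show ?case
    proof
      assume "num_MOLS (k n) n > 0"
      then have "ln (real (num_MOLS (k n) n)) \<le> (real n)\<^sup>2 * (\<Sum>i<k n. level_bound n (i + 2))"
        using elim by (intro ln_num_MOLS_le_level_bounds) auto
      also have "\<dots> \<le> (real n)\<^sup>2 * (real (k n) * l - l\<^sup>2 * profile_integral (y n)
          + (\<Sum>i<k n. 2 / (real i + 1)))"
        unfolding y_def l_def by (intro mult_left_mono sum_level_bound_le elim) simp
      also have "\<dots> \<le> (real n)\<^sup>2 * (real (k n) * l - l\<^sup>2 * profile_integral (y n) + (2 + 2 * ln (real (k n))))"
        by (intro mult_left_mono add_left_mono sum_inverse_le_ln k1) simp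
      \<comment> \<open>As \<open>k = y l\<close>, the terms of order \<open>k ln n\<close> cancel
        down to \<open>l\<^sup>2\<close> times the deficit
        \<open>y - profile_integral y\<close>.\<close>
      also have "\<dots> = (real n)\<^sup>2 * (l\<^sup>2 * (y n - profile_integral (y n)) + (2 + 2 * (ln (y n) + ln l)))"
        unfolding lnk by (simp add: kl power2_eq_square algebra_simps)
      also have "\<dots> \<le> (real n)\<^sup>2 * (l\<^sup>2 * (1 + ln (y n) / 2) + (2 + 2 * (ln (y n) + ln l)))"
        using elim by (intro mult_left_mono add_right_mono profile_integral_ge_ln) auto
      also have "l\<^sup>2 * (1 + ln (y n) / 2) + (2 + 2 * (ln (y n) + ln l)) = (1 / 2 + \<epsilon> n) * ln (y n) * l\<^sup>2"
        unfolding \<epsilon>_def l_def[symmetric] using l lny by (simp add: field_simps)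
      finally show "ln (real (num_MOLS (k n) n)) \<le>
          (1 / 2 + \<epsilon> n) * (ln (real (k n)) - ln (ln (real n))) * (real n)\<^sup>2 * (ln (real n))\<^sup>2"
        unfolding l_def[symmetric] lnk by (simp add: mult_ac)
    qed
  qed
  ultimately show "\<exists>\<epsilon> :: nat \<Rightarrow> real. \<epsilon> \<longlonglongrightarrow> 0 \<and>
      (\<forall>\<^sub>F n in sequentially. num_MOLS (k n) n > 0 \<longrightarrow> ln (real (num_MOLS (k n) n)) \<le>
         (1 / 2 + \<epsilon> n) * (ln (real (k n)) - ln (ln (real n))) * (real n)\<^sup>2 * (ln (real n))\<^sup>2)"
    by blast
qed

end
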